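(* Let $P$ be a finite poset on $[d]$, let $\mathrm{Min}(P)$ be the set of minimal elements of $P$, and for $S\subseteq\mathrm{Min}(P)$ let $E_S(P)$ be the set of edges of the Hasse diagram of $P$ incident to some element of $S$. Then the edge partition $\ell=(E(P)\setminus E_S(P),\,E_S(P))$ is integral, i.e. $\mathcal{OC}_\ell(P)$ has all its vertices in $\mathbb{Z}^d$.
   Context: For a finite poset $(P,\preccurlyeq)$ on $[d]=\{1,\dots,d\}$: the order polytope $\mathcal{O}(P)$ is the set of $(x_1,\dots,x_d)\in\mathbb{R}^d$ with $0\le x_i\le 1$ for all $i$ and $x_i\ge x_j$ whenever $i\preccurlyeq j$ in $P$. The chain polytope $\mathcal{C}(P)$ is the set of $(x_1,\dots,x_d)\in\mathbb{R}^d$ with $x_i\ge 0$ for all $i$ and $x_{i_1}+\dots+x_{i_k}\le 1$ for every maximal chain $i_1\prec\dots\prec i_k$ of $P$. Let $E(P)$ be the set of edges of the Hasse diagram of $P$. An edge partition of $P$ is an ordered pair $\ell=(oE(P),cE(P))$ of disjoint subsets of $E(P)$ with union $E(P)$. Let $P'_\ell$ (resp. $P''_\ell$) be the poset on $[d]$ whose Hasse diagram has edge set $oE(P)$ (resp. $cE(P)$). The order-chain polytope is $\mathcal{OC}_\ell(P)=\mathcal{O}(P'_\ell)\cap\mathcal{C}(P''_\ell)$. The edge partition $\ell$ is integral if $\mathcal{OC}_\ell(P)$ is an integral polytope. *)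

theory Defs
  imports "HOL-Analysis.Analysis"
begin

text \<open>
  The ground set of a poset is a finite type \<^typ>\<open>'n\<close> playing the role of \<open>[d]\<close> with \<open>d = CARD('n)\<close>;
  a poset is a relation \<open>R\<close> with \<open>partial_order_on UNIV R\<close>, where \<open>(i, j) \<in> R\<close> means \<open>i \<preceq> j\<close>.
\<close>

definition order_polytope :: "('n::finite) rel \<Rightarrow> (real ^ 'n) set" where
  "order_polytope R =
     {x. (\<forall>i. 0 \<le> x $ i \<and> x $ i \<le> 1) \<and> (\<forall>i j. (i, j) \<in> R \<longrightarrow> x $ i \<ge> x $ j)}"

definition chain_polytope :: "('n::finite) rel \<Rightarrow> (real ^ 'n) set" where
  "chain_polytope R =
     {x. (\<forall>i. 0 \<le> x $ i) \<and>
         (\<forall>C. pred_on.maxchain UNIV (\<lambda>i j. (i, j) \<in> R) C \<longrightarrow> (\<Sum>i\<in>C. x $ i) \<le> 1)}"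

text \<open>Hasse edges are the cover relations, oriented from the smaller to the larger endpoint.\<close>

definition hasse_edges :: "'a rel \<Rightarrow> 'a rel" where
  "hasse_edges R =
     {(i, j). (i, j) \<in> R \<and> i \<noteq> j \<and>
        \<not> (\<exists>k. (i, k) \<in> R \<and> k \<noteq> i \<and> (k, j) \<in> R \<and> k \<noteq> j)}"

text \<open>
  Well defined when \<open>F\<close> consists of Hasse edges of some finite poset, which is the only case
  of interest; it is then the reflexive transitive closure of \<open>F\<close> (lemma \<open>poset_of_hasse_eq\<close>).
\<close>

definition poset_of_hasse :: "'a rel \<Rightarrow> 'a rel" where
  "poset_of_hasse F = (THE Q. partial_order_on UNIV Q \<and> hasse_edges Q = F)"

definition edge_partition :: "'a rel \<Rightarrow> 'a rel \<times> 'a rel \<Rightarrow> bool" where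
  "edge_partition R l \<longleftrightarrow> fst l \<inter> snd l = {} \<and> fst l \<union> snd l = hasse_edges R"

definition order_chain_polytope :: "('n::finite) rel \<times> 'n rel \<Rightarrow> (real ^ 'n) set" where
  "order_chain_polytope l =
     order_polytope (poset_of_hasse (fst l)) \<inter> chain_polytope (poset_of_hasse (snd l))"

definition integral_polytope :: "(real ^ 'n::finite) set \<Rightarrow> bool" where
  "integral_polytope K \<longleftrightarrow>
     polytope K \<and> (\<forall>v. v extreme_point_of K \<longrightarrow> (\<forall>i. v $ i \<in> \<int>))"

definition integral_edge_partition :: "('n::finite) rel \<Rightarrow> 'n rel \<times> 'n rel \<Rightarrow> bool" where
  "integral_edge_partition R l \<longleftrightarrow>
     edge_partition R l \<and> integral_polytope (order_chain_polytope l)"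

definition minimal_elements :: "'a rel \<Rightarrow> 'a set" where
  "minimal_elements R = {i. \<not> (\<exists>j. (j, i) \<in> R \<and> j \<noteq> i)}"

definition incident_edges :: "'a rel \<Rightarrow> 'a set \<Rightarrow> 'a rel" where
  "incident_edges R S = {(i, j) \<in> hasse_edges R. i \<in> S \<or> j \<in> S}"

lemma partial_order_on_UNIV_iff:
  "partial_order_on UNIV R \<longleftrightarrow> refl R \<and> trans R \<and> antisym R"
  by (auto simp: partial_order_on_def preorder_on_def)

lemma partial_order_eq_rtrancl_hasse:
  fixes Q :: "('n::finite) rel"
  assumes "partial_order_on UNIV Q"
  shows "Q = (hasse_edges Q)\<^sup>*"
proof
  have rf: "refl Q" and tr: "trans Q" and as: "antisym Q"
    using assms by (auto simp: partial_order_on_UNIV_iff)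
  have "hasse_edges Q \<subseteq> Q" by (auto simp: hasse_edges_def)
  then have "(hasse_edges Q)\<^sup>* \<subseteq> Q\<^sup>*" by (rule rtrancl_mono)
  also have "Q\<^sup>* = Q"
  proof -
    have "Q \<union> Id = Q" using rf by (auto simp: refl_on_def)
    then show ?thesis using trancl_id[OF tr] reflcl_trancl[of Q] by simp
  qed
  finally show "(hasse_edges Q)\<^sup>* \<subseteq> Q" .
  have "(i, j) \<in> (hasse_edges Q)\<^sup>*" if "(i, j) \<in> Q" for i j
    using that
  proof (induction "card {k. (i, k) \<in> Q \<and> (k, j) \<in> Q}" arbitrary: i j rule: less_induct)
    case less
    let ?I = "\<lambda>i j. {k. (i, k) \<in> Q \<and> (k, j) \<in> Q}"
    consider "i = j" | "(i, j) \<in> hasse_edges Q"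
      | k where "(i, k) \<in> Q" "k \<noteq> i" "(k, j) \<in> Q" "k \<noteq> j"
      using less.prems by (auto simp: hasse_edges_def)
    then show ?case
    proof cases
      case 3
      have "i \<in> ?I i j" "j \<in> ?I i j" using less.prems rf by (auto simp: refl_on_def)
      moreover have "j \<notin> ?I i k" "i \<notin> ?I k j" using 3 as by (auto dest: antisymD)
      moreover have "?I i k \<subseteq> ?I i j" "?I k j \<subseteq> ?I i j" using 3 tr by (auto dest: transD)
      ultimately have "?I i k \<subset> ?I i j" "?I k j \<subset> ?I i j" by blast+
      then have "card (?I i k) < card (?I i j)" "card (?I k j) < card (?I i j)"
        by (auto intro: psubset_card_mono)
      with less.hyps 3 have "(i, k) \<in> (hasse_edges Q)\<^sup>*" "(k, j) \<in> (hasse_edges Q)\<^sup>*" by blast+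
      then show ?thesis by (rule rtrancl_trans)
    qed auto
  qed
  then show "Q \<subseteq> (hasse_edges Q)\<^sup>*" by auto
qed

lemma sub_hasse_poset:
  fixes R :: "('n::finite) rel"
  assumes R: "partial_order_on UNIV R" and F: "F \<subseteq> hasse_edges R"
  shows "partial_order_on UNIV (F\<^sup>*)" and "hasse_edges (F\<^sup>*) = F"
proof -
  have as: "antisym R" using R by (auto simp: partial_order_on_UNIV_iff)
  have sub: "F\<^sup>* \<subseteq> R"
    using rtrancl_mono[OF F] partial_order_eq_rtrancl_hasse[OF R] by simp
  show po: "partial_order_on UNIV (F\<^sup>*)"
    using antisym_subset[OF sub as]
    by (auto simp: partial_order_on_UNIV_iff refl_rtrancl trans_rtrancl)
  show "hasse_edges (F\<^sup>*) = F"
  proof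
    show "F \<subseteq> hasse_edges (F\<^sup>*)"
    proof
      fix e assume e: "e \<in> F"
      obtain i j where ij: "e = (i, j)" by (cases e)
      have h: "(i, j) \<in> hasse_edges R" using e F ij by blast
      have "(i, j) \<in> F\<^sup>*" using e ij by blast
      then show "e \<in> hasse_edges (F\<^sup>*)"
        using h sub unfolding ij hasse_edges_def by blast
    qed
    show "hasse_edges (F\<^sup>*) \<subseteq> F"
    proof
      fix e assume e: "e \<in> hasse_edges (F\<^sup>*)"
      obtain i j where ij: "e = (i, j)" by (cases e)
      have "(i, j) \<in> F\<^sup>*" "i \<noteq> j" using e ij by (auto simp: hasse_edges_def)
      then obtain k where k: "(i, k) \<in> F" "(k, j) \<in> F\<^sup>*" by (metis converse_rtranclE)
      have "k \<noteq> i" using k F by (auto simp: hasse_edges_def)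
      then have "k = j" using e ij k by (auto simp: hasse_edges_def)
      then show "e \<in> F" using k ij by simp
    qed
  qed
qed

lemma poset_of_hasse_eq:
  fixes R :: "('n::finite) rel"
  assumes "partial_order_on UNIV R" "F \<subseteq> hasse_edges R"
  shows "poset_of_hasse F = F\<^sup>*"
  unfolding poset_of_hasse_def
  using sub_hasse_poset[OF assms] partial_order_eq_rtrancl_hasse
  by (intro the_equality) auto

end

(*
  Reflecting the coordinates in S by x |-> 1 - x turns the order-chain polytope into an order
  polytope, so it is stable under applying any monotone self-map f of [0,1] to all reflected
  coordinates. The maps t^2 and 1 - (1 - t)^2 = 2t - t^2 average to the identity and agree only
  at 0 and 1, so every non-integral point is the midpoint of two distinct points of the polytope.
*)
theory Submission
  imports Defs
begin

lemma polyhedron_coord_ge: "polyhedron {x :: real ^ 'n. c \<le> x $ i}"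
  using polyhedron_halfspace_ge[where a = "axis i (1::real)" and b = c]
  by (simp add: inner_axis')

lemma polyhedron_coord_le: "polyhedron {x :: real ^ 'n. x $ i \<le> c}"
  using polyhedron_halfspace_le[where a = "axis i (1::real)" and b = c]
  by (simp add: inner_axis')

lemma polyhedron_coord_mono: "polyhedron {x :: real ^ 'n. x $ j \<le> x $ i}"
  using polyhedron_halfspace_ge[where a = "axis i 1 - axis j (1::real)" and b = 0]
  by (simp add: inner_axis' inner_diff_left)

lemma polyhedron_coord_sum_le: "polyhedron {x :: real ^ 'n. (\<Sum>i\<in>C. x $ i) \<le> c}"
  using polyhedron_halfspace_le[where a = "\<Sum>i\<in>C. axis i (1::real)" and b = c]
  by (simp add: inner_axis' inner_sum_left)

lemma polyhedron_INT:
  assumes "finite I" "\<And>i. i \<in> I \<Longrightarrow> polyhedron (A i)"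
  shows "polyhedron (\<Inter>i\<in>I. A i)"
  using assms by (intro polyhedron_Inter) auto

lemma polytope_order_polytope: "polytope (order_polytope R)"
proof -
  have "order_polytope R = (\<Inter>i. {x. 0 \<le> x $ i}) \<inter> (\<Inter>i. {x. x $ i \<le> 1}) \<inter>
      (\<Inter>(i, j)\<in>R. {x. x $ j \<le> x $ i})"
    by (auto simp: order_polytope_def)
  moreover have "polyhedron \<dots>"
    by (intro polyhedron_Int polyhedron_INT)
      (auto intro: polyhedron_coord_ge polyhedron_coord_le polyhedron_coord_mono)
  moreover have "bounded (order_polytope R)"
    by (rule bounded_subset[OF bounded_cbox[of 0 1]])
      (auto simp: order_polytope_def mem_box_cart)
  ultimately show ?thesis
    by (simp add: polytope_eq_bounded_polyhedron)
qed

lemma polyhedron_chain_polytope: "polyhedron (chain_polytope R)"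
proof -
  have "chain_polytope R = (\<Inter>i. {x. 0 \<le> x $ i}) \<inter>
      (\<Inter>C\<in>{C. pred_on.maxchain UNIV (\<lambda>i j. (i, j) \<in> R) C}. {x. (\<Sum>i\<in>C. x $ i) \<le> 1})"
    by (auto simp: chain_polytope_def)
  moreover have "polyhedron \<dots>"
    by (intro polyhedron_Int polyhedron_INT)
      (auto intro: polyhedron_coord_ge polyhedron_coord_sum_le)
  ultimately show ?thesis by simp
qed

text \<open>Boundedness is inherited from the order part, which lies in the unit cube; the chain
  part only contributes halfspaces.\<close>

lemma polytope_order_chain_polytope: "polytope (order_chain_polytope l)"
  unfolding order_chain_polytope_def
  using polytope_order_polytope polyhedron_chain_polytope bounded_Int
  by (metis polyhedron_Int polytope_eq_bounded_polyhedron)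

text \<open>The conjugate of the coordinatewise map \<open>f\<close> by the reflection in
  \<open>S\<close>. Working with it directly avoids introducing the reflected polytope.\<close>

definition reflected_map :: "'n set \<Rightarrow> (real \<Rightarrow> real) \<Rightarrow> real ^ 'n \<Rightarrow> real ^ 'n" where
  "reflected_map S f x = (\<chi> i. if i \<in> S then 1 - f (1 - x $ i) else f (x $ i))"

text \<open>Nontrivial relations compare coordinates outside \<open>S\<close>, where
  \<open>f\<close> acts without reflection and monotonicity suffices; coordinates in
  \<open>S\<close> only have to stay in the unit interval.\<close>

lemma reflected_map_order_polytope:
  assumes f: "mono_on {0..1} f" "f \<in> {0..1} \<rightarrow> {0..1}"
    and R: "R \<subseteq> Id \<union> (- S) \<times> (- S)"
    and x: "x \<in> order_polytope R"
  shows "reflected_map S f x \<in> order_polytope R"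
proof -
  have x01: "x $ i \<in> {0..1}" "1 - x $ i \<in> {0..1}" for i
    using x by (auto simp: order_polytope_def)
  have "f (x $ j) \<le> f (x $ i)" if "(i, j) \<in> R" for i j
    using x that by (intro mono_onD[OF f(1)] x01) (auto simp: order_polytope_def)
  moreover have "f (x $ i) \<in> {0..1}" "f (1 - x $ i) \<in> {0..1}" for i
    using f(2) x01 by blast+
  ultimately show ?thesis
    using R by (fastforce simp: order_polytope_def reflected_map_def)
qed

text \<open>Chains have at most two elements, and for a chain \<open>{s, j}\<close> with
  \<open>s\<close> in \<open>S\<close> the bound \<open>x $ s + x $ j \<le> 1\<close> is the order
  inequality \<open>x $ j \<le> 1 - x $ s\<close>, which a monotone \<open>f\<close>
  preserves.\<close>

lemma reflected_map_chain_polytope: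
  assumes f: "mono_on {0..1} f" "f \<in> {0..1} \<rightarrow> {0..1}"
    and R: "R \<subseteq> Id \<union> S \<times> (- S)"
    and x: "x \<in> chain_polytope R" "\<And>i. x $ i \<le> 1"
  shows "reflected_map S f x \<in> chain_polytope R"
proof -
  have x01: "x $ i \<in> {0..1}" "1 - x $ i \<in> {0..1}" for i
    using x by (auto simp: chain_polytope_def)
  have fx: "f (x $ i) \<in> {0..1}" "f (1 - x $ i) \<in> {0..1}" for i
    using f(2) x01 by blast+
  let ?y = "reflected_map S f x"
  have y01: "?y $ i \<in> {0..1}" for i
    using fx by (auto simp: reflected_map_def)
  have "(\<Sum>i\<in>C. ?y $ i) \<le> 1" if C: "pred_on.maxchain UNIV (\<lambda>i j. (i, j) \<in> R) C" for C
  proof -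
    have chain: "i = j \<or> (i, j) \<in> R \<or> (j, i) \<in> R" if "i \<in> C" "j \<in> C" for i j
      using C that unfolding pred_on.maxchain_def pred_on.chain_def by blast
    \<comment> \<open>Every nontrivial relation leads from \<open>S\<close> to its complement, so a
      chain meets each of the two sets at most once.\<close>
    have side: "i = j" if "i \<in> C" "j \<in> C" "i \<in> S \<longleftrightarrow> j \<in> S" for i j
      using chain[OF that(1,2)] R that(3) by blast
    consider "C = {}" | i where "C = {i}" | s j where "C = {s, j}" "s \<in> S" "j \<notin> S"
    proof (cases "C \<inter> S = {} \<or> C - S = {}")
      case True
      with side have "C = {} \<or> (\<exists>i. C = {i})" by blast
      with that show ?thesis by blast
    next
      case False
      then obtain s j where "s \<in> C" "s \<in> S" "j \<in> C" "j \<notin> S" by blast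
      with side have "C = {s, j}" by blast
      with \<open>s \<in> S\<close> \<open>j \<notin> S\<close> that show ?thesis by blast
    qed
    then show ?thesis
    proof cases
      case (3 s j)
      then have "s \<noteq> j" by blast
      with x(1) C 3 have "x $ j \<le> 1 - x $ s"
        by (force simp: chain_polytope_def)
      then have "f (x $ j) \<le> f (1 - x $ s)"
        by (intro mono_onD[OF f(1)] x01)
      with 3 \<open>s \<noteq> j\<close> show ?thesis
        by (simp add: reflected_map_def)
    qed (use y01 in auto)
  qed
  with y01 show ?thesis
    by (auto simp: chain_polytope_def)
qed

lemma extreme_point_integral:
  fixes v :: "real ^ 'n::finite"
  assumes v: "v extreme_point_of K"
    and v01: "\<And>i. v $ i \<in> {0..1}"
    and K: "\<And>f. mono_on {0..1} f \<Longrightarrow> f \<in> {0..1} \<rightarrow> {0..1} \<Longrightarrow> reflected_map S f v \<in> K"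
  shows "v $ i \<in> \<int>"
proof -
  define a where "a = reflected_map S (\<lambda>t. t\<^sup>2) v"
  define b where "b = reflected_map S (\<lambda>t. 1 - (1 - t)\<^sup>2) v"
  have "a \<in> K" unfolding a_def
    by (rule K) (auto intro!: mono_onI power_mono power_le_one)
  moreover have "b \<in> K" unfolding b_def
    by (rule K) (auto intro!: mono_onI power_mono power_le_one)
  \<comment> \<open>The two maps are interchanged by conjugation with
    \<open>t \<mapsto> 1 - t\<close>, so on \<open>S\<close> the coordinates of \<open>a\<close> and
    \<open>b\<close> merely swap formulas and the average is unchanged.\<close>
  moreover have "v = midpoint a b"
    by (simp add: vec_eq_iff midpoint_def a_def b_def reflected_map_def power2_eq_square
        field_simps)
  ultimately have "a = b"
    using v midpoint_in_open_segment by (metis extreme_point_of_def)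
  then have "a $ i = b $ i" by simp
  \<comment> \<open>Up to sign, \<open>a $ i\<close> and \<open>b $ i\<close> differ by twice this
    product.\<close>
  then have "v $ i * (1 - v $ i) = 0"
    by (auto simp: a_def b_def reflected_map_def power2_eq_square algebra_simps split: if_splits)
  then show ?thesis by auto
qed

text \<open>A nonempty path starts with an edge leaving \<open>A\<close> and ends with an edge
  entering \<open>B\<close>. This carries the position of the edges relative to \<open>S\<close>
  over to the generated posets.\<close>

lemma rtrancl_subset_Id_Times:
  assumes "F \<subseteq> A \<times> B"
  shows "F\<^sup>* \<subseteq> Id \<union> A \<times> B"
proof -
  have "(x, y) \<in> Id \<union> A \<times> B" if "(x, y) \<in> F\<^sup>*" for x y
    using that by induction (use assms in auto)
  then show ?thesis by auto
qed

theorem theorem2p2: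
  fixes P :: "('n::finite) rel" and S :: "'n set"
  assumes "partial_order_on UNIV P"
    and "S \<subseteq> minimal_elements P"
  shows "integral_edge_partition P (hasse_edges P - incident_edges P S, incident_edges P S)"
proof -
  define oE where "oE = hasse_edges P - incident_edges P S"
  define cE where "cE = incident_edges P S"
  have sub: "oE \<subseteq> hasse_edges P" "cE \<subseteq> hasse_edges P"
    by (auto simp: oE_def cE_def incident_edges_def)
  have K: "order_chain_polytope (oE, cE) = order_polytope (oE\<^sup>*) \<inter> chain_polytope (cE\<^sup>*)"
    using sub assms(1) by (simp add: order_chain_polytope_def poset_of_hasse_eq)
  have oE: "oE\<^sup>* \<subseteq> Id \<union> (- S) \<times> (- S)"
    by (rule rtrancl_subset_Id_Times) (auto simp: oE_def incident_edges_def)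
  \<comment> \<open>The upper end of an edge is not minimal, hence not in \<open>S\<close>, so an
    incident edge must have its lower end in \<open>S\<close>.\<close>
  have "cE \<subseteq> S \<times> (- S)"
    using assms(2) by (auto simp: cE_def incident_edges_def hasse_edges_def minimal_elements_def)
  then have cE: "cE\<^sup>* \<subseteq> Id \<union> S \<times> (- S)"
    by (rule rtrancl_subset_Id_Times)
  have "v $ i \<in> \<int>" if v: "v extreme_point_of order_chain_polytope (oE, cE)" for v i
  proof (rule extreme_point_integral[OF v])
    have vK: "v \<in> order_polytope (oE\<^sup>*)" "v \<in> chain_polytope (cE\<^sup>*)"
      using v by (auto simp: extreme_point_of_def K)
    \<comment> \<open>The order part bounds all coordinates, including those in \<open>S\<close>,
      which supplies the upper bound required for the chain part.\<close>
    then show v01: "v $ i \<in> {0..1}" for i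
      by (auto simp: order_polytope_def)
    fix f :: "real \<Rightarrow> real"
    assume f: "mono_on {0..1} f" "f \<in> {0..1} \<rightarrow> {0..1}"
    show "reflected_map S f v \<in> order_chain_polytope (oE, cE)"
      using reflected_map_order_polytope[OF f oE vK(1)]
        reflected_map_chain_polytope[OF f cE vK(2)] v01 by (simp add: K)
  qed
  moreover have "edge_partition P (oE, cE)"
    using sub by (auto simp: edge_partition_def oE_def cE_def)
  ultimately have "integral_edge_partition P (oE, cE)"
    by (simp add: integral_edge_partition_def integral_polytope_def
        polytope_order_chain_polytope)
  then show ?thesis
    unfolding oE_def cE_def .
qed

end
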